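(* Let $M\ge 2$ be an integer, $P=2M$, and let $\mathbb{D}\subset\mathbb{N}$ be either the uniform linear array $\mathbb{U}_P=\{0,1,\dots,P-1\}$ or the nested array $\mathbb{S}=\mathbb{U}_M\cup\big((M+1)\mathbb{U}_M+M\big)$ (both have $P$ elements). Let $N\ge P$ be an integer with $\mathbb{D}\subseteq\mathbb{U}_N=\{0,1,\dots,N-1\}$. Let $\theta\in[-\frac{\pi}{2},\frac{\pi}{2})$, $\alpha>0$, $\epsilon>0$, and let $\bm{y}=\alpha\bm{a}_{\mathbb{D}}(\theta)+\bm{n}\in\mathbb{C}^P$ with $\|\bm{n}\|_2\le\epsilon$. Put $\rho=(\alpha/\epsilon)^2$ and assume $\rho\ge 25/P$. Let $\hat{\bm{t}}\in\mathbb{C}^N$ be any solution (global minimizer) of $$\underset{\bm{t}\in\mathbb{C}^N}{\text{minimize}}\ \operatorname{rank}\mathcal{T}(\bm{t})\quad\text{subject to}\quad \|\bm{y}-\bm{t}_{\mathbb{D}}\|_2\le\epsilon,\ \ \mathcal{T}(\bm{t})\succeq 0,$$ let $\hat{\alpha}>0$ and $\hat\theta\in[-\frac{\pi}{2},\frac{\pi}{2})$ be such that $\hat{\bm{t}}=\hat\alpha\,\bm{a}(\hat\theta)$ (every solution is of this form under the present assumptions), and define the angular error $$\Delta_{\mathbb{D}}=\min_{k\in\mathbb{Z}}|\sin\hat\theta-\sin\theta+2k|.$$ Then $\Delta_{\mathbb{D}}\le 1.2/P$ if $\mathbb{D}=\mathbb{U}_P$, and $\Delta_{\mathbb{D}}\le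 8/P^2$ if $\mathbb{D}=\mathbb{S}$.
   Context: For an integer $m\ge1$, $\mathbb{U}_m=\{0,1,\dots,m-1\}$; for integers $c,b$ and a set $\mathbb{X}$ of integers, $c\,\mathbb{X}+b=\{cx+b: x\in\mathbb{X}\}$. For $\theta\in[-\frac{\pi}{2},\frac{\pi}{2})$, $\bm{a}(\theta)\in\mathbb{C}^N$ is the vector with entries $a_i(\theta)=e^{j\pi(i-1)\sin\theta}$, $i=1,\dots,N$, where $j$ is the imaginary unit. For a finite set $\mathbb{D}=\{d_1<d_2<\dots<d_P\}\subseteq\mathbb{U}_N$ with $d_1=0$, $\bm{a}_{\mathbb{D}}(\theta)\in\mathbb{C}^P$ has entries $[\bm{a}_{\mathbb{D}}(\theta)]_i=e^{j\pi d_i\sin\theta}$. For $\bm{t}\in\mathbb{C}^N$, $\bm{t}_{\mathbb{D}}\in\mathbb{C}^P$ is the subvector with entries $t_{d_i+1}$, $i=1,\dots,P$. $\mathcal{T}(\bm{t})\in\mathbb{C}^{N\times N}$ denotes the Hermitian Toeplitz matrix whose first column is $\bm{t}$ (so feasibility requires the first entry of $\bm{t}$ to be real), and $\succeq 0$ means positive semidefinite. *)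

theory Defs
  imports
    "HOL-Analysis.L2_Norm"
    "Jordan_Normal_Form.DL_Rank"
    "Jordan_Normal_Form.Schur_Decomposition"
begin

definition nested_array :: "nat \<Rightarrow> nat set" where
  "nested_array M = {..<M} \<union> (\<lambda>x. (M + 1) * x + M) ` {..<M}"

(* Vectors are indexed from 0, so entry i is the entry numbered i + 1 in the usual notation. *)

definition steering :: "nat \<Rightarrow> real \<Rightarrow> complex vec" where
  "steering N \<theta> = vec N (\<lambda>i. exp (\<i> * of_real (pi * real i * sin \<theta>)))"

definition array_steering :: "nat set \<Rightarrow> real \<Rightarrow> complex vec" where
  "array_steering D \<theta> =
     vec (card D) (\<lambda>i. exp (\<i> * of_real (pi * real (sorted_list_of_set D ! i) * sin \<theta>)))"

definition subvec :: "nat set \<Rightarrow> complex vec \<Rightarrow> complex vec" where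
  "subvec D t = vec (card D) (\<lambda>i. t $ (sorted_list_of_set D ! i))"

definition l2norm :: "complex vec \<Rightarrow> real" where
  "l2norm v = L2_set (\<lambda>i. cmod (v $ i)) {..<dim_vec v}"

(* If the first entry of t is not real, this matrix is not Hermitian, hence not psd. *)

definition toeplitz :: "complex vec \<Rightarrow> complex mat" where
  "toeplitz t = mat (dim_vec t) (dim_vec t)
     (\<lambda>(i, j). if j \<le> i then t $ (i - j) else cnj (t $ (j - i)))"

(* In the order on complex numbers, 0 \<le> z means that z is real and nonnegative. *)

definition psd :: "complex mat \<Rightarrow> bool" where
  "psd A \<longleftrightarrow> square_mat A \<and> mat_adjoint A = A \<and>
     (\<forall>v \<in> carrier_vec (dim_row A). 0 \<le> (A *\<^sub>v v) \<bullet>c v)"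

definition feasible :: "nat \<Rightarrow> nat set \<Rightarrow> real \<Rightarrow> complex vec \<Rightarrow> complex vec \<Rightarrow> bool" where
  "feasible N D \<epsilon> y t \<longleftrightarrow>
     t \<in> carrier_vec N \<and> l2norm (y - subvec D t) \<le> \<epsilon> \<and> psd (toeplitz t)"

definition rank_minimizer :: "nat \<Rightarrow> nat set \<Rightarrow> real \<Rightarrow> complex vec \<Rightarrow> complex vec \<Rightarrow> bool" where
  "rank_minimizer N D \<epsilon> y =
     is_arg_min (\<lambda>t. vec_space.rank N (toeplitz t)) (feasible N D \<epsilon> y)"

(* The infimum is attained, see angular_error_attained. *)

definition angular_error :: "real \<Rightarrow> real \<Rightarrow> real" where
  "angular_error \<theta>' \<theta> = (INF k::int. \<bar>sin \<theta>' - sin \<theta> + 2 * of_int k\<bar>)"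

lemma angular_error_attained:
  "\<exists>k::int. angular_error \<theta>' \<theta> = \<bar>sin \<theta>' - sin \<theta> + 2 * of_int k\<bar> \<and>
     (\<forall>l::int. \<bar>sin \<theta>' - sin \<theta> + 2 * of_int k\<bar> \<le> \<bar>sin \<theta>' - sin \<theta> + 2 * of_int l\<bar>)"
proof -
  define x where "x = sin \<theta>' - sin \<theta>"
  define k where "k = - round (x / 2)"
  have le: "\<bar>x + 2 * of_int k\<bar> \<le> \<bar>x + 2 * of_int l\<bar>" for l :: int
    using round_diff_minimal[of "x / 2" "- l"] by (simp add: k_def)
  have "(INF k::int. \<bar>x + 2 * of_int k\<bar>) = \<bar>x + 2 * of_int k\<bar>"
    by (rule cInf_eq_minimum) (use le in auto)
  with le show ?thesis
    unfolding angular_error_def x_def by blast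
qed

end

theory Submission
  imports Defs "Jordan_Normal_Form.DL_Rank_Submatrix" "HOL-Analysis.Convex"
begin

text \<open>
  The true signal is feasible and has rank one, so a minimizer has rank at most one; the \<open>2 \<times> 2\<close>
  minors of its Toeplitz matrix then force a geometric progression of unimodular ratio. By the
  triangle inequality the two noiseless signals differ by at most \<open>2 \<epsilon> \<le> 2 \<alpha> \<surd>P / 5\<close>, so, with
  \<open>x\<close> the difference of the two sines reduced modulo 2 to \<open>[-1, 1]\<close>, the mean of \<open>cos (\<pi> d x)\<close> over
  \<open>d \<in> D\<close> is at least \<open>\<surd>21 / 5 > 0.916\<close>. On the other hand the geometric sum and Jordan's inequality
  give \<open>\<bar>\<Sum>k<m. e\<^bsup>i\<pi>kx\<^esup>\<bar> \<le> 1 / \<bar>x\<bar>\<close>, which settles the uniform array. For the nested array each of the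
  two blocks must have modulus at least \<open>0.832 M\<close>; the dense block bounds \<open>x\<close> coarsely, and this
  excludes wrap-around of \<open>(M + 1) x\<close> modulo 2 in the sparse block once \<open>M \<ge> 4\<close>.
\<close>

section \<open>Rank-one positive semidefinite Toeplitz matrices\<close>

lemma det_2x2:
  assumes "A \<in> carrier_mat 2 2"
  shows "det A = A $$ (0,0) * A $$ (1,1) - A $$ (0,1) * A $$ (1,0)"
proof -
  have d: "det (mat_delete A i 0) = mat_delete A i 0 $$ (0, 0)" for i
    using assms by (intro det_single mat_delete_carrier) auto
  show ?thesis
    unfolding laplace_expansion_column[OF assms, of 0, simplified]
    using assms unfolding cofactor_def d by (simp add: mat_delete_def numeral_2_eq_2 mult.commute)
qed

text \<open>A nonzero 2 x 2 minor would force the rank to be at least 2.\<close>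

lemma (in vec_space) rank_le_1_minor:
  assumes A: "A \<in> carrier_mat n nc" and r: "rank A \<le> 1"
    and i: "i < n" "i' < n" "i < i'" and j: "j < nc" "j' < nc" "j < j'"
  shows "A $$ (i, j) * A $$ (i', j') = A $$ (i, j') * A $$ (i', j)"
proof -
  define B where "B = submatrix A {i, i'} {j, j'}"
  have I: "{k. k < n \<and> k \<in> {i, i'}} = {i, i'}" and J: "{k. k < nc \<and> k \<in> {j, j'}} = {j, j'}"
    using i j by auto
  have B: "B \<in> carrier_mat 2 2"
    unfolding B_def carrier_mat_def using A I J less_imp_neq[OF i(3)] less_imp_neq[OF j(3)]
    by (simp add: dim_submatrix card_2_iff' del: insert_iff)
  have "det B = 0"
    using rank_gt_minor[OF A, of "{i, i'}" "{j, j'}"] r j unfolding B_def J by auto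
  \<comment> \<open>\<open>submatrix_index_card\<close> locates an entry by the number of selected
    indices below it; these counts are 0 and 1 for rows and columns alike.\<close>
  have below: "{a \<in> {i, i'}. a < i} = {}" "{a \<in> {j, j'}. a < j} = {}"
    "{a \<in> {i, i'}. a < i'} = {i}" "{a \<in> {j, j'}. a < j'} = {j}"
    using i j by auto
  with \<open>det B = 0\<close> show ?thesis
    using submatrix_index_card[of i A j "{i, i'}" "{j, j'}"]
      submatrix_index_card[of i A j' "{i, i'}" "{j, j'}"]
      submatrix_index_card[of i' A j "{i, i'}" "{j, j'}"]
      submatrix_index_card[of i' A j' "{i, i'}" "{j, j'}"] A i j
    unfolding det_2x2[OF B] B_def[symmetric] below by simp
qed

text \<open>The quadratic form at \<open>v\<close> is \<open>a\<close> times the squared modulus of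
  the inner product \<open>s\<close> of \<open>v\<close> with \<open>f\<close>.\<close>

lemma psd_outer_product:
  assumes "0 \<le> (a :: real)"
  shows "psd (mat m m (\<lambda>(i, j). of_real a * f i * cnj (f j)))" (is "psd ?A")
  unfolding psd_def
proof (intro conjI ballI)
  show "square_mat ?A" by simp
  show "mat_adjoint ?A = ?A"
    by (rule eq_matI) (auto simp: mat_adjoint_def mat_of_rows_index)
  fix v :: "complex vec"
  assume "v \<in> carrier_vec (dim_row ?A)"
  then have v: "dim_vec v = m" by simp
  define s where "s = (\<Sum>j = 0..<m. cnj (f j) * v $ j)"
  have cnj_s: "cnj s = (\<Sum>i = 0..<m. f i * cnj (v $ i))"
    by (simp add: s_def)
  have Av: "(?A *\<^sub>v v) $ i = of_real a * f i * s" if "i < m" for i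
    using that v by (simp add: scalar_prod_def s_def sum_distrib_left mult.assoc)
  have "(?A *\<^sub>v v) \<bullet>c v = (\<Sum>i = 0..<m. of_real a * f i * s * cnj (v $ i))"
    using v by (simp add: scalar_prod_def[of _ "conjugate v"] Av del: index_mult_mat_vec)
  also have "\<dots> = of_real a * (s * cnj s)"
    by (simp add: cnj_s sum_distrib_left mult_ac)
  also have "\<dots> = of_real (a * (cmod s)\<^sup>2)"
    by (simp only: complex_norm_square[symmetric] of_real_mult)
  finally show "0 \<le> (?A *\<^sub>v v) \<bullet>c v"
    using assms by (simp add: less_eq_complex_def)
qed

lemma steering_index [simp]:
  "i < N \<Longrightarrow> steering N \<theta> $ i = cis (pi * real i * sin \<theta>)"
  by (simp add: steering_def cis_conv_exp)

lemma dim_steering [simp]: "dim_vec (steering N \<theta>) = N"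
  by (simp add: steering_def)

text \<open>The product of phase i with the conjugate of phase j depends only on i - j. The
  outer-product form yields both positivity and rank at most one.\<close>

lemma toeplitz_steering:
  "toeplitz (of_real a \<cdot>\<^sub>v steering N \<theta>) =
     mat N N (\<lambda>(i, j). of_real a * cis (pi * real i * sin \<theta>) * cnj (cis (pi * real j * sin \<theta>)))"
  by (rule eq_matI)
    (auto simp: toeplitz_def cis_cnj cis_mult of_nat_diff mult.assoc algebra_simps)

lemma psd_toeplitz_steering: "0 \<le> a \<Longrightarrow> psd (toeplitz (of_real a \<cdot>\<^sub>v steering N \<theta>))"
  unfolding toeplitz_steering by (rule psd_outer_product)

lemma rank_toeplitz_steering:
  "vec_space.rank N (toeplitz (of_real a \<cdot>\<^sub>v steering N \<theta>)) \<le> 1"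
  unfolding toeplitz_steering
  by (rule vec_space.rank_le_1_product_entries[where nc = N
        and f = "\<lambda>i. of_real a * cis (pi * real i * sin \<theta>)"
        and g = "\<lambda>j. cnj (cis (pi * real j * sin \<theta>))"]) auto

lemma psd_diag_nonneg:
  assumes "psd A" "i < dim_row A"
  shows "0 \<le> A $$ (i, i)"
proof -
  have sq: "dim_col A = dim_row A" using assms by (simp add: psd_def)
  have "0 \<le> (A *\<^sub>v unit_vec (dim_row A) i) \<bullet>c unit_vec (dim_row A) i"
    using assms by (simp add: psd_def)
  moreover have "conjugate (unit_vec (dim_row A) i) = (unit_vec (dim_row A) i :: complex vec)"
    by (rule eq_vecI) (simp_all add: unit_vec_def)
  ultimately show ?thesis
    using assms(2) sq by (simp add: mult_mat_vec_def)
qed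

lemma unimodular_eq_cis_sin:
  assumes "cmod z = 1"
  obtains \<theta> where "\<theta> \<in> {- pi / 2..<pi / 2}" "z = cis (pi * sin \<theta>)"
proof -
  have z: "z \<noteq> 0" using assms by auto
  \<comment> \<open>The principal argument lies in (-pi, pi], but the range of \<theta> excludes pi
    / 2, so the value pi is moved to -pi.\<close>
  define \<phi> where "\<phi> = (if Arg z = pi then - pi else Arg z)"
  have "\<phi> \<in> {- pi..<pi}"
    using Arg_bounded[of z] by (auto simp: \<phi>_def)
  moreover have "cis \<phi> = z"
    using cis_Arg[OF z] assms by (auto simp: \<phi>_def sgn_eq cis.ctr complex_eq_iff)
  ultimately have *: "- 1 \<le> \<phi> / pi" "\<phi> / pi < 1" "cis (pi * (\<phi> / pi)) = z"
    by (auto simp: field_simps)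
  show thesis
  proof (rule that[of "arcsin (\<phi> / pi)"])
    have "arcsin (\<phi> / pi) < arcsin 1"
      using * by (intro arcsin_less_arcsin) auto
    then show "arcsin (\<phi> / pi) \<in> {- pi / 2..<pi / 2}"
      using arcsin_bounded[of "\<phi> / pi"] * by auto
    show "z = cis (pi * sin (arcsin (\<phi> / pi)))"
      using * by simp
  qed
qed

lemma psd_toeplitz_rank_le_1:
  assumes t: "t \<in> carrier_vec N" "t \<noteq> 0\<^sub>v N" and N: "N \<ge> 2"
    and psd: "psd (toeplitz t)" and rank: "vec_space.rank N (toeplitz t) \<le> 1"
  obtains a \<theta> where "a > 0" "\<theta> \<in> {- pi / 2..<pi / 2}" "t = of_real a \<cdot>\<^sub>v steering N \<theta>"
proof -
  have dim: "dim_vec t = N" using t by simp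
  define a where "a = Re (t $ 0)"
  have "0 \<le> t $ 0"
    using psd_diag_nonneg[OF psd, of 0] N by (simp add: toeplitz_def dim)
  then have t0: "t $ 0 = of_real a" and a0: "a \<ge> 0"
    by (simp_all add: a_def less_eq_complex_def complex_eq_iff)
  \<comment> \<open>The minor with rows 0, i + 1 and columns 0, 1. For i = 0 it also gives the
    modulus of \<open>t $ 1\<close>.\<close>
  have step: "of_real a * t $ i = t $ Suc i * cnj (t $ 1)" if "Suc i < N" for i
    using vec_space.rank_le_1_minor[OF _ rank, of N 0 "Suc i" 0 1] that N
    by (simp add: toeplitz_def dim t0 mult.commute)
  have t1: "cmod (t $ 1) = a"
  proof -
    have "complex_of_real (a * a) = t $ 1 * cnj (t $ 1)"
      using step[of 0] N t0 by simp
    also have "\<dots> = of_real ((cmod (t $ 1))\<^sup>2)"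
      by (simp only: complex_norm_square[symmetric])
    finally have "a\<^sup>2 = (cmod (t $ 1))\<^sup>2"
      by (simp only: of_real_eq_iff power2_eq_square)
    with a0 show ?thesis by simp
  qed
  \<comment> \<open>If \<open>a\<close> vanished, the principal minor on 0 and i would read 0 =
    |t_i|^2 for every i > 0, making \<open>t\<close> zero.\<close>
  have "a \<noteq> 0"
  proof
    assume a: "a = 0"
    have z: "t $ i = 0" if "i < N" for i
    proof (cases "i = 0")
      case True
      with a t0 show ?thesis by simp
    next
      case False
      have "t $ 0 * t $ 0 = cnj (t $ i) * t $ i"
        using vec_space.rank_le_1_minor[OF _ rank, of N 0 i 0 i] that False N
        by (simp add: toeplitz_def dim)
      with a t0 show ?thesis by simp
    qed
    have "t = 0\<^sub>v N"
      by (rule eq_vecI) (simp_all add: z dim)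
    with t(2) show False by simp
  qed
  with a0 have a: "a > 0" by simp
  define z where "z = t $ 1 / of_real a"
  have "cmod z = 1" using t1 a by (simp add: z_def norm_divide)
  then obtain \<theta> where \<theta>: "\<theta> \<in> {- pi / 2..<pi / 2}" "z = cis (pi * sin \<theta>)"
    by (rule unimodular_eq_cis_sin)
  have "t $ i = of_real a * z ^ i" if "i < N" for i
    using that
  proof (induction i)
    case 0
    show ?case by (simp add: t0)
  next
    case (Suc i)
    \<comment> \<open>Since |t_1| = a, multiplying by a^2 inserts
      \<open>t $ 1 * cnj (t $ 1)\<close>, which turns \<open>step\<close> into a forward recursion
      of ratio \<open>z\<close>.\<close>
    have "of_real a * of_real a * t $ Suc i = t $ Suc i * (t $ 1 * cnj (t $ 1))"
      by (simp only: complex_norm_square[symmetric] t1) (simp add: power2_eq_square)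
    also have "\<dots> = of_real a * t $ i * t $ 1"
      by (simp add: step[OF Suc.prems])
    finally have "t $ Suc i = t $ i * z"
      using a by (simp add: z_def field_simps)
    with Suc show ?case by simp
  qed
  then have "t = of_real a \<cdot>\<^sub>v steering N \<theta>"
    by (intro eq_vecI) (simp_all add: dim \<theta>(2) Complex.DeMoivre mult_ac)
  with a \<theta>(1) that show thesis by blast
qed

section \<open>Exponential sums\<close>

text \<open>Sine is concave on [0, pi / 2], so it lies above its chord there.\<close>

lemma Jordan_sin_inequality:
  fixes x :: real
  assumes "0 \<le> x" "x \<le> 1"
  shows "x \<le> sin (pi / 2 * x)"
proof -
  have "convex_on {0..pi / 2} (\<lambda>x. - sin x)"
    by (rule f''_ge0_imp_convex[where f' = "\<lambda>x. - cos x" and f'' = sin])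
      (auto intro!: derivative_eq_intros sin_ge_zero)
  from convex_onD[OF this, of x 0 "pi / 2"] assms show ?thesis
    by (simp add: mult.commute)
qed

lemma cmod_cis_minus_1_ge:
  assumes "\<bar>x\<bar> \<le> 1"
  shows "2 * \<bar>x\<bar> \<le> cmod (cis (pi * x) - 1)"
proof -
  have "(cmod (cis (pi * x) - 1))\<^sup>2 = 2 - 2 * cos (pi * x)"
    using sin_cos_squared_add[of "pi * x"]
    unfolding cmod_power2 by (simp add: power2_eq_square algebra_simps)
  also have "\<dots> = 2 - 2 * cos (2 * (pi / 2 * \<bar>x\<bar>))"
    by (cases "x \<ge> 0") simp_all
  also have "\<dots> = (2 * sin (pi / 2 * \<bar>x\<bar>))\<^sup>2"
    unfolding cos_double_sin by (simp add: power2_eq_square)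
  finally have "cmod (cis (pi * x) - 1) = \<bar>2 * sin (pi / 2 * \<bar>x\<bar>)\<bar>"
    by (metis norm_ge_zero power2_eq_iff_nonneg abs_ge_zero power2_abs)
  then show ?thesis
    using Jordan_sin_inequality[of "\<bar>x\<bar>"] assms by linarith
qed

text \<open>Multiplying the geometric sum by z - 1 leaves z^m - 1, of modulus at most 2, while |z -
  1| is at least 2 |x|. The product form covers x = 0 as well.\<close>

lemma cmod_geometric_sum_cis_le:
  assumes "\<bar>x\<bar> \<le> 1"
  shows "cmod (\<Sum>k<m. cis (pi * real k * x)) * \<bar>x\<bar> \<le> 1"
proof -
  define z where "z = cis (pi * x)"
  have S: "(\<Sum>k<m. cis (pi * real k * x)) = (\<Sum>k<m. z ^ k)"
    by (simp add: z_def Complex.DeMoivre mult_ac)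
  have "cmod (\<Sum>k<m. z ^ k) * (2 * \<bar>x\<bar>) \<le> cmod (\<Sum>k<m. z ^ k) * cmod (z - 1)"
    using cmod_cis_minus_1_ge[OF assms] by (intro mult_left_mono) (auto simp: z_def)
  also have "\<dots> = cmod (z ^ m - 1)"
    by (simp add: power_diff_1_eq norm_mult mult.commute)
  also have "\<dots> \<le> cmod (z ^ m) + cmod 1"
    by (rule norm_triangle_ineq4)
  also have "\<dots> = 2"
    by (simp add: z_def norm_power)
  finally show ?thesis by (simp add: S)
qed

text \<open>Sensor positions are integers, so a shift of x by an even integer adds whole turns to
  the phase.\<close>

lemma cos_period_reduction: "cos (pi * real d * (x + 2 * of_int k)) = cos (pi * real d * x)"
proof -
  have "pi * real d * (x + 2 * of_int k) = pi * real d * x + 2 * pi * of_int (int d * k)"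
    by (simp add: algebra_simps)
  then show ?thesis
    by (simp add: cos_add sin_int_2pin cos_int_2pin del: of_int_mult)
qed

lemma sum_cos_eq_Re_sum_cis: "(\<Sum>k\<in>A. cos (f k)) = Re (\<Sum>k\<in>A. cis (f k))"
  by simp

section \<open>Offset bounds for the uniform and the nested array\<close>

lemma ULA_correlation_imp:
  assumes "m > 0" "\<bar>x\<bar> \<le> 1" "0.916 * real m \<le> (\<Sum>d<m. cos (pi * real d * x))"
  shows "\<bar>x\<bar> \<le> 1.2 / real m"
proof -
  have "0.916 * real m \<le> cmod (\<Sum>d<m. cis (pi * real d * x))"
    using assms(3) complex_Re_le_cmod unfolding sum_cos_eq_Re_sum_cis by (rule order_trans)
  from mult_right_mono[OF this, of "\<bar>x\<bar>"] cmod_geometric_sum_cis_le[OF assms(2), of m]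
  have "0.916 * real m * \<bar>x\<bar> \<le> 1" by linarith
  \<comment> \<open>1 / 0.916 is below 1.2.\<close>
  then show ?thesis using assms(1) by (simp add: field_simps)
qed

lemma finite_nested_array: "finite (nested_array M)"
  by (simp add: nested_array_def)

lemma card_nested_array: "card (nested_array M) = 2 * M"
  and sum_nested_array:
    "(\<Sum>d\<in>nested_array M. f d) = (\<Sum>k<M. f k) + (\<Sum>k<M. (f ((M + 1) * k + M) :: 'a :: comm_monoid_add))"
proof -
  have inj: "inj_on (\<lambda>x. (M + 1) * x + M) {..<M}"
    by (rule inj_onI) (simp del: mult_Suc)
  \<comment> \<open>The sparse block starts at M, just past the dense one.\<close>
  have disj: "{..<M} \<inter> (\<lambda>x. (M + 1) * x + M) ` {..<M} = {}"
    by auto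
  show "card (nested_array M) = 2 * M"
    using card_Un_disjoint[OF _ _ disj] card_image[OF inj] by (simp only: nested_array_def) simp
  show "(\<Sum>d\<in>nested_array M. f d) = (\<Sum>k<M. f k) + (\<Sum>k<M. f ((M + 1) * k + M))"
    using sum.union_disjoint[OF _ _ disj, of f] sum.reindex[OF inj, of f]
    by (simp only: nested_array_def) simp
qed

lemma sum_cos_imp_cos_pos:
  assumes "finite A" "a \<in> A" "real (card A) - 1 < (\<Sum>d\<in>A. cos (f d))"
  shows "0 < cos (f a)"
proof -
  have "(\<Sum>d\<in>A. cos (f d)) = cos (f a) + (\<Sum>d\<in>A - {a}. cos (f d))"
    using assms by (intro sum.remove) auto
  also have "(\<Sum>d\<in>A - {a}. cos (f d)) \<le> real (card (A - {a})) * 1"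
    by (rule sum_bounded_above) simp
  also have "real (card (A - {a})) = real (card A) - 1"
    using card_Suc_Diff1[OF assms(1,2)] by linarith
  finally show ?thesis using assms(3) by simp
qed

text \<open>On [1/2, 3/2] the value cos (pi x) is never positive: a shift by 1/2 turns it into minus
  a sine on [0, pi].\<close>

lemma cos_pos_imp_lt_half:
  fixes x :: real
  assumes "0 < cos (pi * x)" "0 \<le> x" "x \<le> 3 / 2"
  shows "x < 1 / 2"
proof (rule ccontr)
  assume "\<not> ?thesis"
  then have "0 \<le> pi * (x - 1 / 2)" "pi * (x - 1 / 2) \<le> pi * 1"
    using assms by (auto intro!: mult_left_mono simp del: mult_1_right)
  then have "0 \<le> sin (pi * (x - 1 / 2))"
    by (intro sin_ge_zero) auto
  moreover have "pi * x = pi * (x - 1 / 2) + pi / 2"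
    by (simp add: algebra_simps)
  then have "cos (pi * x) = - sin (pi * (x - 1 / 2))"
    by (simp only: cos_add cos_pi_half sin_pi_half)
  ultimately show False using assms(1) by simp
qed

text \<open>For \<open>M \<le> 3\<close> wrap-around is not excluded by block moduli, but a mean above \<open>1 - 1 / (2 M)\<close>
  forces every single cosine to be positive.\<close>

lemma nested_correlation_imp_small:
  assumes M: "M = 2 \<or> M = 3" and x: "\<bar>x\<bar> \<le> 1"
    and corr: "0.916 * real (2 * M) \<le> (\<Sum>d\<in>nested_array M. cos (pi * real d * x))"
  shows "\<bar>x\<bar> \<le> 2 / (real M)\<^sup>2"
proof -
  \<comment> \<open>The required 2 M - 1 < 1.832 M amounts to 0.168 M < 1.\<close>
  have pos: "0 < cos (pi * real d * x)" if "d \<in> nested_array M" for d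
    by (rule sum_cos_imp_cos_pos[OF _ that, of "\<lambda>d. pi * real d * x"])
      (use corr M in \<open>auto simp: card_nested_array finite_nested_array\<close>)
  have abs: "0 < cos (pi * (real d * \<bar>x\<bar>))" if "d \<in> nested_array M" for d
    using pos[OF that] by (cases "x \<ge> 0") (simp_all add: mult.assoc)
  \<comment> \<open>Sensor 1 gives |x| < 1/2, which suffices for M = 2. It also puts 3 |x| below
    3/2, so for M = 3 sensor 3 improves this to |x| < 1/6, below 2/9.\<close>
  have "\<bar>x\<bar> < 1 / 2"
    using cos_pos_imp_lt_half[of "\<bar>x\<bar>"] abs[of 1] M x by (auto simp: nested_array_def)
  moreover have "3 * \<bar>x\<bar> < 1 / 2" if "M = 3" "\<bar>x\<bar> < 1 / 2"
    using cos_pos_imp_lt_half[of "3 * \<bar>x\<bar>"] abs[of 3] that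
    by (force simp: nested_array_def)
  ultimately show ?thesis
    using M by (auto simp: power2_eq_square)
qed

lemma nested_correlation_imp_large:
  assumes M: "M \<ge> 4" and x: "\<bar>x\<bar> \<le> 1"
    and corr: "0.916 * real (2 * M) \<le> (\<Sum>d\<in>nested_array M. cos (pi * real d * x))"
  shows "\<bar>x\<bar> \<le> 2 / (real M)\<^sup>2"
proof -
  define A where "A = (\<Sum>k<M. cis (pi * real k * x))"
  \<comment> \<open>\<eta> is (M + 1) x reduced modulo 2 to [-1, 1], and \<open>l\<close> counts the
    wraps. Up to a unimodular factor the sparse block is the geometric sum \<open>B\<close> in
    \<eta>.\<close>
  define l where "l = round ((real M + 1) * x / 2)"
  define \<eta> where "\<eta> = (real M + 1) * x - 2 * of_int l"
  define B where "B = (\<Sum>k<M. cis (pi * real k * \<eta>))"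
  have \<eta>: "\<bar>\<eta>\<bar> \<le> 1"
    using of_int_round_abs_le[of "(real M + 1) * x / 2"] unfolding \<eta>_def l_def by linarith
  have le: "cmod (\<Sum>k<M. cis (f k)) \<le> real M" for f
    using norm_sum[of "\<lambda>k. cis (f k)" "{..<M}"] by simp
  have "cis (pi * real ((M + 1) * k + M) * x) = cis (pi * real M * x) * cis (pi * real k * \<eta>)" for k
  proof -
    have "pi * real ((M + 1) * k + M) * x =
        pi * real M * x + pi * real k * \<eta> + 2 * pi * of_int (int k * l)"
      by (simp add: \<eta>_def algebra_simps)
    moreover have "cis (2 * pi * of_int (int k * l)) = 1"
      by (rule cis_multiple_2pi) simp
    ultimately show ?thesis by (simp only: cis_mult[symmetric]) simp
  qed
  then have "(\<Sum>d\<in>nested_array M. cos (pi * real d * x)) = Re (A + cis (pi * real M * x) * B)"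
    unfolding sum_cos_eq_Re_sum_cis sum_nested_array A_def B_def by (simp add: sum_distrib_left)
  also have "\<dots> \<le> cmod (A + cis (pi * real M * x) * B)"
    by (rule complex_Re_le_cmod)
  also have "\<dots> \<le> cmod A + cmod B"
    using norm_triangle_ineq[of A "cis (pi * real M * x) * B"] by (simp add: norm_mult)
  finally have sum: "1.832 * real M \<le> cmod A + cmod B"
    using corr by simp
  have "cmod A \<le> real M" "cmod B \<le> real M"
    unfolding A_def B_def by (rule le)+
  \<comment> \<open>Neither block exceeds M, so each must supply at least 1.832 M - M.\<close>
  with sum have "0.832 * real M \<le> cmod A" "0.832 * real M \<le> cmod B"
    by simp_all
  from mult_right_mono[OF this(1), of "\<bar>x\<bar>"] mult_right_mono[OF this(2), of "\<bar>\<eta>\<bar>"]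
  have bounds: "0.832 * real M * \<bar>x\<bar> \<le> 1" "0.832 * real M * \<bar>\<eta>\<bar> \<le> 1"
    using cmod_geometric_sum_cis_le[OF x, of M] cmod_geometric_sum_cis_le[OF \<eta>, of M]
    unfolding A_def B_def by linarith+
  have M': "real M \<ge> 4" using M by simp
  \<comment> \<open>1.202 is 1 / 0.832 rounded up.\<close>
  have x': "\<bar>x\<bar> \<le> 1.202 / real M" and \<eta>': "\<bar>\<eta>\<bar> \<le> 1.202 / real M"
    using bounds M' by (simp_all add: field_simps)
  \<comment> \<open>For M at least 4, |2 l| is at most 1.202 + 2.404 / M, hence at most 1.803, which
    is below 2.\<close>
  have "l = 0"
  proof -
    have inv: "1 / real M \<le> 1 / 4"
      using M' by (intro divide_left_mono) auto
    have "(real M + 1) * \<bar>x\<bar> \<le> (real M + 1) * (1.202 / real M)"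
      using x' by (intro mult_left_mono) auto
    also have "\<dots> = 1.202 + 1.202 * (1 / real M)"
      using M' by (simp add: field_simps)
    finally have "(real M + 1) * \<bar>x\<bar> \<le> 1.202 + 1.202 * (1 / real M)" .
    moreover have "\<bar>2 * of_int l :: real\<bar> \<le> (real M + 1) * \<bar>x\<bar> + \<bar>\<eta>\<bar>"
      using abs_triangle_ineq4[of "(real M + 1) * x" \<eta>] by (simp add: \<eta>_def abs_mult)
    ultimately have "\<bar>2 * of_int l :: real\<bar> < 2"
      using \<eta>' inv by simp
    then show ?thesis by linarith
  qed
  then have "(real M + 1) * \<bar>x\<bar> \<le> 1.202 / real M"
    using \<eta>' by (simp add: \<eta>_def abs_mult)
  moreover have "real M * \<bar>x\<bar> \<le> (real M + 1) * \<bar>x\<bar>"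
    by (intro mult_right_mono) auto
  moreover have "1.202 / real M \<le> 2 / real M"
    by (intro divide_right_mono) auto
  ultimately have "real M * \<bar>x\<bar> \<le> 2 / real M" by linarith
  then show ?thesis using M' by (simp add: field_simps power2_eq_square)
qed

section \<open>From the data fit to a correlation bound\<close>

lemma cmod_cis_diff_squared:
  "(cmod (of_real a * cis u - of_real b * cis v))\<^sup>2 = a\<^sup>2 + b\<^sup>2 - 2 * a * b * cos (v - u)"
proof -
  have "(cmod (of_real a * cis u - of_real b * cis v))\<^sup>2 =
      a\<^sup>2 * ((sin u)\<^sup>2 + (cos u)\<^sup>2) + b\<^sup>2 * ((sin v)\<^sup>2 + (cos v)\<^sup>2) - 2 * a * b * cos (v - u)"
    unfolding cmod_power2 by (simp add: cos_diff power2_eq_square algebra_simps del: sin_cos_squared_add3)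
  then show ?thesis by simp
qed

text \<open>The unknown amplitude \<open>b\<close> is eliminated by completing the square. The
  constant 0.160944 is 1 - 0.916^2; it exceeds 4/25, the most that \<open>e\<close> and
  \<open>close\<close> allow.\<close>

lemma close_imp_correlated:
  fixes a b C p e :: real
  assumes pos: "0 < a" "0 < b" "0 < p"
    and e: "25 * e\<^sup>2 \<le> p * a\<^sup>2"
    and close: "p * a\<^sup>2 + p * b\<^sup>2 - 2 * a * b * C \<le> 4 * e\<^sup>2"
  shows "0.916 * p \<le> C"
proof (rule ccontr)
  assume "\<not> ?thesis"
  then have "2 * a * b * C < 2 * a * b * (0.916 * p)"
    using pos by (intro mult_strict_left_mono) auto
  moreover have "p * (a\<^sup>2 + b\<^sup>2 - 1.832 * a * b) = p * ((b - 0.916 * a)\<^sup>2 + 0.160944 * a\<^sup>2)"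
    by (simp add: power2_eq_square algebra_simps)
  moreover have "p * (0.160944 * a\<^sup>2) \<le> p * ((b - 0.916 * a)\<^sup>2 + 0.160944 * a\<^sup>2)"
    using pos by (intro mult_left_mono) auto
  moreover have "0 < p * a\<^sup>2" using pos by simp
  ultimately show False using close e by (simp add: algebra_simps)
qed

lemma sum_sorted_list_of_set_nth:
  assumes "finite D"
  shows "(\<Sum>i<card D. f (sorted_list_of_set D ! i)) = sum f D"
  by (rule sum.reindex_bij_betw, rule bij_betw_nth) (use assms in auto)

lemma sorted_list_of_set_nth_mem: "finite D \<Longrightarrow> i < card D \<Longrightarrow> sorted_list_of_set D ! i \<in> D"
  by (metis length_sorted_list_of_set nth_mem set_sorted_list_of_set)

section \<open>Noisy data and the feasible signals\<close>

context
  fixes N P :: nat and D :: "nat set" and \<theta> \<alpha> \<epsilon> :: real and y n :: "complex vec"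
  assumes D: "D \<subseteq> {..<N}" "card D = P"
    and \<alpha>: "\<alpha> > 0" and \<epsilon>: "\<epsilon> > 0" and P: "P > 0"
    and n: "n \<in> carrier_vec P" "l2norm n \<le> \<epsilon>"
    and y: "y = of_real \<alpha> \<cdot>\<^sub>v array_steering D \<theta> + n"
    and snr: "25 * \<epsilon>\<^sup>2 \<le> real P * \<alpha>\<^sup>2"
begin

lemma finite_sensors: "finite D"
  using D(1) finite_subset by blast

lemma dim_data: "dim_vec y = P" "dim_vec n = P"
  using n by (simp_all add: y)

lemma data_index:
  "i < P \<Longrightarrow> y $ i = of_real \<alpha> * cis (pi * real (sorted_list_of_set D ! i) * sin \<theta>) + n $ i"
  using dim_data D(2) by (simp add: y array_steering_def cis_conv_exp)

text \<open>The residual of the true signal is exactly the noise. This is the rank-one competitor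
  against which a minimizer is compared.\<close>

lemma true_signal_feasible: "feasible N D \<epsilon> y (of_real \<alpha> \<cdot>\<^sub>v steering N \<theta>)"
proof -
  have "y - subvec D (of_real \<alpha> \<cdot>\<^sub>v steering N \<theta>) = n"
  proof (rule eq_vecI)
    fix i assume "i < dim_vec n"
    then have i: "i < P" using dim_data by simp
    then have "sorted_list_of_set D ! i < N"
      using sorted_list_of_set_nth_mem[OF finite_sensors, of i] D by auto
    then show "(y - subvec D (of_real \<alpha> \<cdot>\<^sub>v steering N \<theta>)) $ i = n $ i"
      using i D(2) by (simp add: subvec_def data_index)
  qed (simp add: subvec_def dim_data D)
  moreover have "of_real \<alpha> \<cdot>\<^sub>v steering N \<theta> \<in> carrier_vec N"
    by (rule carrier_vecI) simp
  ultimately show ?thesis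
    using n \<alpha> by (simp add: feasible_def psd_toeplitz_steering)
qed

text \<open>The noiseless data and the samples of \<open>s\<close> both lie within \<epsilon> of
  \<open>y\<close>, hence within 2 \<epsilon> of each other.\<close>

lemma feasible_dist:
  assumes "feasible N D \<epsilon> y s"
  shows "(\<Sum>d\<in>D. (cmod (of_real \<alpha> * cis (pi * real d * sin \<theta>) - s $ d))\<^sup>2) \<le> 4 * \<epsilon>\<^sup>2"
proof -
  define f where "f i = of_real \<alpha> * cis (pi * real (sorted_list_of_set D ! i) * sin \<theta>)
    - s $ (sorted_list_of_set D ! i)" for i
  define r where "r = y - subvec D s"
  have r: "dim_vec r = P" "l2norm r \<le> \<epsilon>"
    using assms D by (simp_all add: r_def subvec_def feasible_def)
  have f: "f i = r $ i - n $ i" if "i < P" for i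
    using that D(2) by (simp add: f_def r_def data_index subvec_def)
  have "L2_set (\<lambda>i. cmod (f i)) {..<P} \<le> L2_set (\<lambda>i. cmod (r $ i) + cmod (n $ i)) {..<P}"
    by (rule L2_set_mono) (simp_all add: f norm_triangle_ineq4)
  also have "\<dots> \<le> L2_set (\<lambda>i. cmod (r $ i)) {..<P} + L2_set (\<lambda>i. cmod (n $ i)) {..<P}"
    by (rule L2_set_triangle_ineq)
  also have "\<dots> \<le> 2 * \<epsilon>"
    using r n by (simp add: l2norm_def dim_data)
  finally have "(L2_set (\<lambda>i. cmod (f i)) {..<P})\<^sup>2 \<le> (2 * \<epsilon>)\<^sup>2"
    by (intro power_mono L2_set_nonneg)
  then have "(\<Sum>i<P. (cmod (f i))\<^sup>2) \<le> 4 * \<epsilon>\<^sup>2"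
    by (simp add: L2_set_def sum_nonneg power_mult_distrib)
  then show ?thesis
    using sum_sorted_list_of_set_nth[OF finite_sensors,
        of "\<lambda>d. (cmod (of_real \<alpha> * cis (pi * real d * sin \<theta>) - s $ d))\<^sup>2"]
    by (simp add: f_def D(2))
qed

text \<open>Rank zero must be excluded to obtain a positive amplitude. At zero the distance bound
  would give P \<alpha>^2 \<le> 4 \<epsilon>^2, against \<open>snr\<close>.\<close>

lemma zero_not_feasible: "\<not> feasible N D \<epsilon> y (0\<^sub>v N)"
proof
  assume "feasible N D \<epsilon> y (0\<^sub>v N)"
  from feasible_dist[OF this]
  have "(\<Sum>d\<in>D. (cmod (of_real \<alpha> * cis (pi * real d * sin \<theta>) - 0\<^sub>v N $ d))\<^sup>2) \<le> 4 * \<epsilon>\<^sup>2" .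
  moreover have "(cmod (of_real \<alpha> * cis (pi * real d * sin \<theta>) - 0\<^sub>v N $ d))\<^sup>2 = \<alpha>\<^sup>2" if "d \<in> D" for d
    using that D \<alpha> by (auto simp: norm_mult)
  ultimately have "real P * \<alpha>\<^sup>2 \<le> 4 * \<epsilon>\<^sup>2" using D(2) by simp
  moreover have "0 < \<epsilon>\<^sup>2" using \<epsilon> by simp
  ultimately show False using snr by linarith
qed

lemma rank_minimizer_is_steering:
  assumes min: "rank_minimizer N D \<epsilon> y t" and N: "N \<ge> 2"
  shows "\<exists>a>0. \<exists>\<theta>'\<in>{- pi / 2..<pi / 2}. t = of_real a \<cdot>\<^sub>v steering N \<theta>'"
proof -
  have feas: "feasible N D \<epsilon> y t"
    using min by (simp add: rank_minimizer_def is_arg_min_def)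
  have "vec_space.rank N (toeplitz t) \<le> 1"
    using min true_signal_feasible rank_toeplitz_steering[of N \<alpha> \<theta>]
    unfolding rank_minimizer_def is_arg_min_def by (meson leI le_trans)
  moreover have "t \<noteq> 0\<^sub>v N"
    using feas zero_not_feasible by auto
  ultimately show ?thesis
    using psd_toeplitz_rank_le_1[of t N] feas N unfolding feasible_def by metis
qed

lemma feasible_steering_correlated:
  assumes "feasible N D \<epsilon> y (of_real b \<cdot>\<^sub>v steering N \<theta>')" "b > 0"
  shows "0.916 * real P \<le> (\<Sum>d\<in>D. cos (pi * real d * (sin \<theta>' - sin \<theta>)))"
proof -
  have "(\<Sum>d\<in>D. \<alpha>\<^sup>2 + b\<^sup>2 - 2 * \<alpha> * b * cos (pi * real d * (sin \<theta>' - sin \<theta>))) =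
     (\<Sum>d\<in>D. (cmod (of_real \<alpha> * cis (pi * real d * sin \<theta>)
        - (of_real b \<cdot>\<^sub>v steering N \<theta>') $ d))\<^sup>2)"
  proof (rule sum.cong)
    fix d assume "d \<in> D"
    then have "(of_real b \<cdot>\<^sub>v steering N \<theta>') $ d = of_real b * cis (pi * real d * sin \<theta>')"
      using D by auto
    then show "\<alpha>\<^sup>2 + b\<^sup>2 - 2 * \<alpha> * b * cos (pi * real d * (sin \<theta>' - sin \<theta>)) =
      (cmod (of_real \<alpha> * cis (pi * real d * sin \<theta>) - (of_real b \<cdot>\<^sub>v steering N \<theta>') $ d))\<^sup>2"
      by (simp add: cmod_cis_diff_squared right_diff_distrib)
  qed simp
  also have "\<dots> \<le> 4 * \<epsilon>\<^sup>2"
    by (rule feasible_dist[OF assms(1)])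
  finally have "real P * \<alpha>\<^sup>2 + real P * b\<^sup>2
      - 2 * \<alpha> * b * (\<Sum>d\<in>D. cos (pi * real d * (sin \<theta>' - sin \<theta>))) \<le> 4 * \<epsilon>\<^sup>2"
    by (simp add: sum_subtractf sum.distrib sum_distrib_left D(2) distrib_left)
  from close_imp_correlated[OF \<alpha> assms(2) _ snr this] P show ?thesis by simp
qed

end

section \<open>Reduction of the sine offset modulo 2 and the final bounds\<close>

lemma angular_error_obtain:
  obtains x where "angular_error \<theta>' \<theta> = \<bar>x\<bar>" "\<bar>x\<bar> \<le> 1"
    "\<And>d::nat. cos (pi * real d * (sin \<theta>' - sin \<theta>)) = cos (pi * real d * x)"
proof -
  obtain k :: int where k: "angular_error \<theta>' \<theta> = \<bar>sin \<theta>' - sin \<theta> + 2 * of_int k\<bar>"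
    and min: "\<And>l::int. \<bar>sin \<theta>' - sin \<theta> + 2 * of_int k\<bar> \<le> \<bar>sin \<theta>' - sin \<theta> + 2 * of_int l\<bar>"
    using angular_error_attained[of \<theta>' \<theta>] by blast
  show thesis
  proof (rule that)
    \<comment> \<open>A minimal representative cannot be shortened by moving it by 2 in either
      direction.\<close>
    show "\<bar>sin \<theta>' - sin \<theta> + 2 * of_int k\<bar> \<le> 1"
      using min[of "k - 1"] min[of "k + 1"] by (simp add: abs_le_iff abs_if split: if_splits)
  qed (simp_all add: k cos_period_reduction)
qed

theorem theorem1:
  fixes M P N :: nat and D :: "nat set" and \<theta> \<alpha> \<epsilon> \<rho> :: real and y n t :: "complex vec"
  assumes "M \<ge> 2" and "P = 2 * M"
    and "D = {..<P} \<or> D = nested_array M"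
    and "N \<ge> P" and "D \<subseteq> {..<N}"
    and "\<theta> \<in> {- pi / 2..<pi / 2}" and "\<alpha> > 0" and "\<epsilon> > 0"
    and "n \<in> carrier_vec P" and "l2norm n \<le> \<epsilon>"
    and "y = of_real \<alpha> \<cdot>\<^sub>v array_steering D \<theta> + n"
    and "\<rho> = (\<alpha> / \<epsilon>)\<^sup>2" and "\<rho> \<ge> 25 / real P"
    and "rank_minimizer N D \<epsilon> y t"
  shows "(\<exists>\<alpha>'>0. \<exists>\<theta>'\<in>{- pi / 2..<pi / 2}. t = of_real \<alpha>' \<cdot>\<^sub>v steering N \<theta>') \<and>
    (\<forall>\<alpha>'>0. \<forall>\<theta>'\<in>{- pi / 2..<pi / 2}. t = of_real \<alpha>' \<cdot>\<^sub>v steering N \<theta>' \<longrightarrow>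
       (D = {..<P} \<longrightarrow> angular_error \<theta>' \<theta> \<le> 1.2 / real P) \<and>
       (D = nested_array M \<longrightarrow> angular_error \<theta>' \<theta> \<le> 8 / (real P)\<^sup>2))"
proof -
  have card: "card D = P"
    using assms(2,3) by (auto simp: card_nested_array)
  have P: "P > 0" and N: "N \<ge> 2" using assms(1,2,4) by auto
  have "25 / real P * (real P * \<epsilon>\<^sup>2) \<le> (\<alpha> / \<epsilon>)\<^sup>2 * (real P * \<epsilon>\<^sup>2)"
    using assms(12,13) by (intro mult_right_mono) auto
  then have snr: "25 * \<epsilon>\<^sup>2 \<le> real P * \<alpha>\<^sup>2"
    using P assms(8) by (simp add: power_divide mult.commute)
  note setting = assms(5) card assms(7,8) P assms(9,10,11) snr
  have feas: "feasible N D \<epsilon> y t"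
    using assms(14) by (simp add: rank_minimizer_def is_arg_min_def)
  show ?thesis
  proof (intro conjI allI impI ballI)
    show "\<exists>\<alpha>'>0. \<exists>\<theta>'\<in>{- pi / 2..<pi / 2}. t = of_real \<alpha>' \<cdot>\<^sub>v steering N \<theta>'"
      by (rule rank_minimizer_is_steering[OF setting assms(14) N])
  next
    fix \<alpha>' \<theta>' :: real
    assume \<alpha>': "\<alpha>' > 0" and t: "t = of_real \<alpha>' \<cdot>\<^sub>v steering N \<theta>'"
    obtain x where x: "angular_error \<theta>' \<theta> = \<bar>x\<bar>" "\<bar>x\<bar> \<le> 1"
      "\<And>d::nat. cos (pi * real d * (sin \<theta>' - sin \<theta>)) = cos (pi * real d * x)"
      by (rule angular_error_obtain[of \<theta>' \<theta>]) blast
    have corr: "0.916 * real P \<le> (\<Sum>d\<in>D. cos (pi * real d * x))"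
      using feasible_steering_correlated[OF setting feas[unfolded t] \<alpha>'] by (simp add: x(3))
    show "angular_error \<theta>' \<theta> \<le> 1.2 / real P" if "D = {..<P}"
      using ULA_correlation_imp[OF P x(2)] corr that x(1) by simp
    show "angular_error \<theta>' \<theta> \<le> 8 / (real P)\<^sup>2" if "D = nested_array M"
    proof -
      have "0.916 * real (2 * M) \<le> (\<Sum>d\<in>nested_array M. cos (pi * real d * x))"
        using corr that assms(2) by simp
      moreover have "M \<ge> 4 \<or> M = 2 \<or> M = 3" using assms(1) by linarith
      \<comment> \<open>As P = 2 M, this bound equals 8 / P^2.\<close>
      ultimately have "\<bar>x\<bar> \<le> 2 / (real M)\<^sup>2"
        using nested_correlation_imp_small[of M x] nested_correlation_imp_large[of M x] x(2)
        by blast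
      then show ?thesis
        using x(1) assms(2) by (simp add: power_mult_distrib)
    qed
  qed
qed

end
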